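(* Let $h\in\mathrm{Lip}_{[2]}(\mathbb{R})$. There exists a constant $C>0$ such that \[ \big|\mathbb{E}\big[\mathscr{L}_0\mathbf{P}^0_t h(Z_n)\big]\big|\le C\,\frac{1+|\log\gamma_t|}{\gamma_t}\,\frac{\log n}{n}\quad\text{for all } t\in[1,\infty) \text{ and all } n\ge2. \]
   Context: $Z$ denotes a standard Gumbel random variable (density $e^{-(x+e^{-x})}$). For $t\ge0$, $\mathbf{P}^0_t f(x)=\mathbb{E}\big[f\big(\max(x-t,\ Z+\log(1-e^{-t}))\big)\big]$, and $\mathscr{L}_0 f(x)=-f'(x)+e^{-x}\mathbb{E}[f'(x+Y)]$ with $Y\sim\mathcal{E}(1)$ (the generator of $(\mathbf{P}^0_t)$). $\gamma_t=e^t-1$. $Z_n=\frac{T_n}{n}-\log n$, where $T_n$ is the coupon collector's completion time for $n$ coupons (i.i.d. uniform draws from $\{1,\dots,n\}$ until all have appeared). $\mathrm{Lip}_{[2]}(\mathbb{R})$ is the set of Lipschitz $f:\mathbb{R}\to\mathbb{R}$ whose derivative has a Lipschitz representative. *)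

theory Defs
  imports "HOL-Probability.Probability"
begin

definition gumbel_density :: "real \<Rightarrow> real" where
  "gumbel_density x = exp (- (x + exp (- x)))"

definition gumbel :: "real measure" where
  "gumbel = density lborel gumbel_density"

definition expo1 :: "real measure" where
  "expo1 = density lborel (exponential_density 1)"

definition P0 :: "real \<Rightarrow> (real \<Rightarrow> real) \<Rightarrow> real \<Rightarrow> real" where
  "P0 t f x = (\<integral>z. f (max (x - t) (z + ln (1 - exp (- t)))) \<partial>gumbel)"

definition L0 :: "(real \<Rightarrow> real) \<Rightarrow> real \<Rightarrow> real" where
  "L0 f x = - deriv f x + exp (- x) * (\<integral>y. deriv f (x + y) \<partial>expo1)"

definition gamma_t :: "real \<Rightarrow> real" where
  "gamma_t t = exp t - 1"

definition lip2 :: "(real \<Rightarrow> real) \<Rightarrow> bool" where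
  "lip2 f \<longleftrightarrow> (\<exists>L. L-lipschitz_on UNIV f) \<and>
     (\<exists>g. (\<forall>x. (f has_real_derivative g x) (at x)) \<and> (\<exists>L. L-lipschitz_on UNIV g))"

definition draws :: "nat \<Rightarrow> nat stream measure" where
  "draws n = stream_space (measure_pmf (pmf_of_set {..<n}))"

definition coupon_T :: "nat \<Rightarrow> nat stream \<Rightarrow> nat" where
  "coupon_T n \<omega> = (LEAST m. {..<n} \<subseteq> set (stake m \<omega>))"

definition coupon_Z :: "nat \<Rightarrow> nat stream \<Rightarrow> real" where
  "coupon_Z n \<omega> = real (coupon_T n \<omega>) / real n - ln (real n)"

end

(* Writing c = e^t - 1 and g(x) = h'(x - t) exp(-c e^(-x)), one has (P0 t h)' = g, and L0 (P0 t h) = H - g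
   with H(x) = int_x^infinity g(u) e^(-u) du. Let F_n be the distribution function of T_n.  The last missing
   coupon arrives at time m + 1 with probability
     F_n(m + 1) - F_n(m) = (1 - 1/n)^m F_{n-1}(m),
   a discrete counterpart of the Stein identity E[g(Z)] = E[H(Z)]: with x_m = m/n - log n, E[g(Z_n)] is the sum
   of g(x_{m+1}) (1 - 1/n)^m F_{n-1}(m), which is a Riemann sum for H because (1 - 1/n)^m is nearly e^(-x_m)/n,
   while summation by parts turns E[H(Z_n)] into the sum of (H(x_m) - H(x_{m+1})) F_n(m).  Replacing F_n by
   F_{n-1} costs E[T_n - T_{n-1}] / n = O(log n / n) since H is Lipschitz with constant O(1/c), and the
   Riemann sum error is controlled on the scale s = c e^(-x_m), where the discretisation error of
   (1 - 1/n)^m produces the factor m/n = log n + log c - log s. *)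
theory Submission
  imports Defs
begin

section \<open>Covering probabilities\<close>

text \<open>\<open>cover_prob n j m\<close> is the probability that \<open>m\<close> uniform draws out of \<open>n\<close> coupons contain
  \<open>j\<close> given coupons, computed by conditioning on the first draw; it is meaningful for \<open>j \<le> n\<close>.\<close>
fun cover_prob :: "nat \<Rightarrow> nat \<Rightarrow> nat \<Rightarrow> real" where
  "cover_prob n 0 m = 1"
| "cover_prob n (Suc j) 0 = 0"
| "cover_prob n (Suc j) (Suc m) =
    real (Suc j) / real n * cover_prob n j m + (1 - real (Suc j) / real n) * cover_prob n (Suc j) m"

lemma convex_combination_eq:
  fixes q a b :: real
  shows "q * a + (1 - q) * b = b + q * (a - b)"
  by (simp add: algebra_simps)

lemma cover_prob_bounds:
  assumes "j \<le> n" "0 < n"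
  shows "0 \<le> cover_prob n j m \<and> cover_prob n j m \<le> 1"
  using assms
proof (induction n j m rule: cover_prob.induct)
  case (3 n j m)
  have a: "0 \<le> real (Suc j) / real n" "0 \<le> 1 - real (Suc j) / real n"
    using 3 by (auto simp: field_simps)
  have i: "0 \<le> cover_prob n j m" "cover_prob n j m \<le> 1"
    "0 \<le> cover_prob n (Suc j) m" "cover_prob n (Suc j) m \<le> 1"
    using 3 by auto
  have "real (Suc j) / real n * cover_prob n j m + (1 - real (Suc j) / real n) * cover_prob n (Suc j) m
      \<le> real (Suc j) / real n * 1 + (1 - real (Suc j) / real n) * 1"
    by (intro add_mono mult_left_mono a i)
  moreover have "0 \<le> real (Suc j) / real n * cover_prob n j m + (1 - real (Suc j) / real n) * cover_prob n (Suc j) m"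
    by (intro add_nonneg_nonneg mult_nonneg_nonneg a i)
  ultimately show ?case by simp
qed auto

text \<open>Induction on \<open>m\<close>, with \<open>cover_prob n j m\<close> as an intermediate
  value: one more draw leaves the probability for \<open>Suc j\<close> below it and lifts the one
  for \<open>j\<close> above it.\<close>

lemma cover_prob_decreasing:
  assumes "Suc j \<le> n" "0 < n"
  shows "cover_prob n (Suc j) m \<le> cover_prob n j m"
  using assms
proof (induction m arbitrary: j)
  case 0
  then show ?case using cover_prob_bounds[of j n 0] by simp
next
  case (Suc m)
  have c: "0 \<le> 1 - real (Suc j) / real n" using Suc by (auto simp: field_simps)
  show ?case
  proof (cases j)
    case 0
    then show ?thesis using cover_prob_bounds[of "Suc 0" n "Suc m"] Suc.prems by simp
  next
    case (Suc i)
    let ?q = "real (Suc i) / real n" and ?r = "real (Suc j) / real n"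
    have "cover_prob n (Suc j) (Suc m) \<le> ?r * cover_prob n j m + (1 - ?r) * cover_prob n j m"
      using mult_left_mono[OF Suc.IH[OF Suc.prems] c] by simp
    also have "\<dots> = ?q * cover_prob n j m + (1 - ?q) * cover_prob n j m"
      by (simp add: algebra_simps)
    also have "\<dots> \<le> ?q * cover_prob n i m + (1 - ?q) * cover_prob n j m"
      using mult_left_mono[OF Suc.IH[of i], of ?q] Suc Suc.prems by simp
    finally show ?thesis using Suc by simp
  qed
qed

text \<open>The recursion reads \<open>b + q * (a - b)\<close> with \<open>a - b\<close> nonnegative
  by \<open>cover_prob_decreasing\<close>, so it increases with the weight \<open>q\<close>, and
  enlarging the coupon set lowers \<open>q\<close>.\<close>

lemma cover_prob_antimono:
  assumes "j \<le> n" "0 < n"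
  shows "cover_prob (Suc n) j m \<le> cover_prob n j m"
  using assms
proof (induction m arbitrary: j)
  case 0
  then show ?case by (cases j) auto
next
  case (Suc m)
  show ?case
  proof (cases j)
    case (Suc i)
    let ?q = "real (Suc i) / real (Suc n)" and ?r = "real (Suc i) / real n"
    have qr: "0 \<le> ?q" "?q \<le> ?r" "0 \<le> 1 - ?q"
      using Suc.prems Suc by (auto simp: field_simps)
    have "cover_prob (Suc n) j (Suc m) \<le> ?q * cover_prob n i m + (1 - ?q) * cover_prob n j m"
      unfolding Suc cover_prob.simps
      by (intro add_mono mult_left_mono qr) (use Suc Suc.prems Suc.IH in auto)
    also have "\<dots> = cover_prob n j m + ?q * (cover_prob n i m - cover_prob n j m)"
      by (rule convex_combination_eq)
    also have "\<dots> \<le> cover_prob n j m + ?r * (cover_prob n i m - cover_prob n j m)"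
      using cover_prob_decreasing[of i n m] Suc Suc.prems
      by (intro add_left_mono mult_right_mono qr) auto
    also have "\<dots> = cover_prob n j (Suc m)"
      unfolding Suc cover_prob.simps by (rule convex_combination_eq[symmetric])
    finally show ?thesis .
  qed auto
qed

text \<open>Any of the \<open>Suc j\<close> coupons may be the last, arriving at draw
  \<open>Suc m\<close>; the \<open>m\<close> earlier draws avoid it, and given this they are uniform
  on the other \<open>n\<close> coupons and must contain the remaining \<open>j\<close>.\<close>

lemma cover_prob_increment:
  assumes "j < Suc n" "0 < n"
  shows "cover_prob (Suc n) (Suc j) (Suc m) - cover_prob (Suc n) (Suc j) m
    = real (Suc j) / real (Suc n) * (1 - 1 / real (Suc n)) ^ m * cover_prob n j m"
  using assms
proof (induction m arbitrary: j)
  case 0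
  then show ?case by (cases j) auto
next
  case (Suc m)
  let ?p = "1 - 1 / real (Suc n)" and ?r = "real (Suc j) / real (Suc n)"
  have p: "?p = real n / real (Suc n)" by (simp add: field_simps)
  have "cover_prob (Suc n) (Suc j) (Suc (Suc m)) - cover_prob (Suc n) (Suc j) (Suc m)
    = ?r * (cover_prob (Suc n) j (Suc m) - cover_prob (Suc n) j m)
      + (1 - ?r) * (cover_prob (Suc n) (Suc j) (Suc m) - cover_prob (Suc n) (Suc j) m)"
    by (simp only: cover_prob.simps(3)[of "Suc n" j "Suc m"] cover_prob.simps(3)[of "Suc n" j m])
       (simp only: algebra_simps)
  also have "\<dots> = ?r * (cover_prob (Suc n) j (Suc m) - cover_prob (Suc n) j m)
      + (1 - ?r) * (?r * ?p ^ m * cover_prob n j m)"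
    using Suc.IH[of j] Suc.prems by simp
  also have "\<dots> = ?r * ?p ^ Suc m * cover_prob n j (Suc m)"
  proof (cases j)
    case 0
    then show ?thesis by (simp add: field_simps)
  next
    case (Suc i)
    have ih: "cover_prob (Suc n) j (Suc m) - cover_prob (Suc n) j m =
        real (Suc i) / real (Suc n) * ?p ^ m * cover_prob n i m"
      using Suc.IH[of i] Suc.prems Suc by simp
    \<comment> \<open>One of the \<open>m + 1\<close> factors \<open>?p\<close> converts the
      recursion weights for \<open>n\<close> coupons into those for \<open>Suc n\<close>.\<close>
    have a: "?p * (real (Suc i) / real n) = real (Suc i) / real (Suc n)"
      unfolding p using Suc.prems by simp
    have "?p * (1 - real (Suc i) / real n) = ?p - real (Suc i) / real (Suc n)"
      unfolding right_diff_distrib a by simp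
    also have "\<dots> = 1 - ?r"
      unfolding Suc by (simp add: add_divide_distrib)
    finally have b: "?p * (1 - real (Suc i) / real n) = 1 - ?r" .
    have "?r * ?p ^ Suc m * cover_prob n j (Suc m) =
       ?r * ?p ^ m * ((?p * (real (Suc i) / real n)) * cover_prob n i m
         + (?p * (1 - real (Suc i) / real n)) * cover_prob n j m)"
      unfolding Suc cover_prob.simps by (simp only: algebra_simps power_Suc)
    then show ?thesis unfolding ih a b by (simp only: algebra_simps)
  qed
  finally show ?case .
qed

section \<open>Truncated expected completion times\<close>

text \<open>The sums are expectations of completion times truncated at \<open>N\<close>. While
  \<open>Suc j\<close> coupons are missing, the wait for a new one has mean
  \<open>n / Suc j\<close>, which the truncation multiplies by a covering probability.\<close>

lemma sum_cover_prob_defect_Suc: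
  assumes "Suc j \<le> n" "0 < n"
  shows "(\<Sum>m<N. 1 - cover_prob n (Suc j) m)
    = (\<Sum>m<N. 1 - cover_prob n j m) + real n / real (Suc j) * cover_prob n (Suc j) N"
proof (induction N)
  case (Suc N)
  let ?r = "real (Suc j) / real n"
  have r: "real n / real (Suc j) * ?r = 1" using assms by simp
  have "real n / real (Suc j) * cover_prob n (Suc j) (Suc N) =
      (real n / real (Suc j) * ?r) * cover_prob n j N + real n / real (Suc j) * cover_prob n (Suc j) N
        - (real n / real (Suc j) * ?r) * cover_prob n (Suc j) N"
    by (simp only: cover_prob.simps) (simp only: algebra_simps)
  then show ?case unfolding r by (simp add: Suc)
qed simp

lemma sum_cover_prob_defect:
  assumes "j \<le> n" "0 < n"
  shows "(\<Sum>m<N. 1 - cover_prob n j m) = real n * (\<Sum>i<j. cover_prob n (Suc i) N / real (Suc i))"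
  using assms
proof (induction j)
  case (Suc j)
  then show ?case by (simp add: sum_cover_prob_defect_Suc algebra_simps)
qed simp

text \<open>Truncated form of E[T_{n+1}] - E[T_n] = (n+1) H_{n+1} - n H_n = 1 + H_n, with H_n the
  harmonic number.\<close>

lemma sum_cover_prob_diff_le:
  assumes "0 < n"
  shows "(\<Sum>m<N. cover_prob n n m - cover_prob (Suc n) (Suc n) m) \<le> 1 + harm n"
proof -
  let ?S = "\<lambda>k i. cover_prob k (Suc i) N / real (Suc i)"
  have "(\<Sum>m<N. cover_prob n n m - cover_prob (Suc n) (Suc n) m)
     = (\<Sum>m<N. 1 - cover_prob (Suc n) (Suc n) m) - (\<Sum>m<N. 1 - cover_prob n n m)"
    by (simp add: sum_subtractf[symmetric])
  \<comment> \<open>The summand \<open>i = n\<close> of the longer sum is split off; its factors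
    \<open>Suc n\<close> cancel.\<close>
  also have "\<dots> = cover_prob (Suc n) (Suc n) N + (\<Sum>i<n. real (Suc n) * ?S (Suc n) i - real n * ?S n i)"
    unfolding sum_cover_prob_defect[OF order.refl assms] sum_cover_prob_defect[OF order.refl zero_less_Suc]
    by (simp add: sum_subtractf sum_distrib_left distrib_left del: of_nat_Suc)
  also have "\<dots> \<le> 1 + (\<Sum>i<n. inverse (real (Suc i)))"
  proof (intro add_mono sum_mono)
    show "cover_prob (Suc n) (Suc n) N \<le> 1" using cover_prob_bounds[of "Suc n" "Suc n" N] by simp
    fix i assume "i \<in> {..<n}"
    then have i: "Suc i \<le> n" by simp
    \<comment> \<open>Of the \<open>Suc n\<close> copies of \<open>?S (Suc n) i\<close>,
      \<open>n\<close> are absorbed by monotonicity in the number of coupons; the last one is at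
      most \<open>1 / Suc i\<close>.\<close>
    have "real n * ?S (Suc n) i \<le> real n * ?S n i"
      using cover_prob_antimono[OF i assms, of N]
      by (intro mult_left_mono divide_right_mono) auto
    moreover have "?S (Suc n) i \<le> inverse (real (Suc i))"
      using cover_prob_bounds[of "Suc i" "Suc n" N] i
      by (simp add: divide_right_mono inverse_eq_divide del: of_nat_Suc)
    ultimately show "real (Suc n) * ?S (Suc n) i - real n * ?S n i \<le> inverse (real (Suc i))"
      unfolding of_nat_Suc[of n] distrib_right by linarith
  qed
  also have "(\<Sum>i<n. inverse (real (Suc i))) = harm n"
    unfolding harm_def by (simp add: sum.atLeast_Suc_atMost_Suc_shift[of _ 0] atLeast0AtMost lessThan_Suc_atMost
        sum.atLeast1_atMost_eq)
  finally show ?thesis .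
qed

text \<open>Union bound: \<open>m\<close> draws miss a given coupon with probability
  \<open>(1 - 1 / n) ^ m\<close>.\<close>

lemma cover_prob_ge: 
  assumes "j \<le> n" "0 < n"
  shows "1 - real j * (1 - 1 / real n) ^ m \<le> cover_prob n j m"
  using assms
proof (induction n j m rule: cover_prob.induct)
  case (3 n j m)
  let ?r = "real (Suc j) / real n" and ?P = "(1 - 1 / real n) ^ m"
  have r: "0 \<le> ?r" "0 \<le> 1 - ?r" using 3 by (auto simp: field_simps)
  have "1 - real (Suc j) * (1 - 1 / real n) ^ Suc m
     = ?r * (1 - real j * ?P) + (1 - ?r) * (1 - real (Suc j) * ?P)"
    using 3 by (simp add: field_simps)
  also have "\<dots> \<le> ?r * cover_prob n j m + (1 - ?r) * cover_prob n (Suc j) m"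
    using 3 by (intro add_mono mult_left_mono r) auto
  finally show ?case by simp
qed auto

lemma cover_prob_tendsto_1:
  assumes "j \<le> n" "0 < n"
  shows "cover_prob n j \<longlonglongrightarrow> 1"
proof (rule tendsto_sandwich)
  have "(\<lambda>m. (1 - 1 / real n) ^ m) \<longlonglongrightarrow> 0"
    using assms by (intro LIMSEQ_power_zero) (auto simp: field_simps)
  from tendsto_diff[OF tendsto_const tendsto_mult[OF tendsto_const this], of 1 "real j"]
  show "(\<lambda>m. 1 - real j * (1 - 1 / real n) ^ m) \<longlonglongrightarrow> 1" by simp
qed (use cover_prob_ge cover_prob_bounds assms in auto)

section \<open>Law of the completion time\<close>

lemma prob_space_draws: "prob_space (draws n)"
  unfolding draws_def by (intro prob_space.prob_space_stream_space prob_space_measure_pmf)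

lemma space_draws [simp]: "space (draws n) = UNIV"
  by (simp add: draws_def space_stream_space)

lemma sets_draws: "sets (draws n) = sets (stream_space (count_space UNIV))"
  unfolding draws_def by (intro sets_stream_space_cong) simp

lemma pred_covered [measurable]: "Measurable.pred (draws n) (\<lambda>\<omega>. S \<subseteq> set (stake m \<omega>))"
proof -
  have "stake m \<in> measurable (draws n) (count_space (UNIV :: nat list set))"
    using measurable_stake measurable_cong_sets[OF sets_draws refl] by blast
  then show ?thesis
    by (rule measurable_compose[where g = "\<lambda>xs. S \<subseteq> set xs"]) simp
qed

text \<open>Conditioning on the first draw \<open>t\<close>, the other \<open>m\<close> draws must
  cover \<open>S - {t}\<close>, whose size drops exactly when \<open>t\<close> lies in
  \<open>S\<close>. This reproduces the recursion of \<open>cover_prob\<close>.\<close>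

lemma measure_covered:
  assumes "S \<subseteq> {..<n}" "0 < n"
  shows "measure (draws n) {\<omega>. S \<subseteq> set (stake m \<omega>)} = cover_prob n (card S) m"
  using assms(1)
proof (induction m arbitrary: S)
  case 0
  have "finite S" using 0 finite_subset by auto
  then show ?case using prob_space.prob_space[OF prob_space_draws[of n]]
    by (cases "S = {}"; cases "card S") auto
next
  case (Suc m)
  have fin: "finite S" using Suc.prems finite_subset by auto
  show ?case
  proof (cases "card S")
    case 0
    then show ?thesis using fin prob_space.prob_space[OF prob_space_draws[of n]] by auto
  next
    case (Suc j)
    let ?p = "pmf_of_set {..<n}"
    let ?c = "\<lambda>t. cover_prob n (card (S - {t})) m"
    have jn: "Suc j \<le> n" using Suc.prems Suc card_mono[OF _ Suc.prems] by simp
    have ne: "{..<n} \<noteq> {}" using assms by auto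
    have meas: "{x \<in> space (stream_space (measure_pmf ?p)). S \<subseteq> set (stake (Suc m) x)}
        \<in> sets (stream_space (measure_pmf ?p))"
      using pred_covered[where n = n and S = S and m = "Suc m"] unfolding draws_def pred_def .
    have cover: "measure (draws n) {\<omega>. S \<subseteq> set (stake (Suc m) (t ## \<omega>))} = ?c t" for t
    proof -
      have "{\<omega>. S \<subseteq> set (stake (Suc m) (t ## \<omega>))} = {\<omega>. S - {t} \<subseteq> set (stake m \<omega>)}" by auto
      then show ?thesis using Suc.IH[of "S - {t}"] Suc.prems by auto
    qed
    have nonneg: "0 \<le> ?c t" for t
      by (metis cover measure_nonneg)
    have fin_p: "integrable (measure_pmf ?p) ?c"
      by (rule integrable_measure_pmf_finite) (use ne in simp)
    have "ennreal (measure (draws n) {\<omega>. S \<subseteq> set (stake (Suc m) \<omega>)}) = (\<integral>\<^sup>+t. ?c t \<partial>measure_pmf ?p)"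
      using prob_space.prob_stream_space[OF prob_space_measure_pmf meas, folded draws_def] cover by simp
    also have "\<dots> = ennreal (\<integral>t. ?c t \<partial>measure_pmf ?p)"
      by (intro nn_integral_eq_integral fin_p) (use nonneg in auto)
    finally have "measure (draws n) {\<omega>. S \<subseteq> set (stake (Suc m) \<omega>)} = (\<integral>t. ?c t \<partial>measure_pmf ?p)"
      using nonneg by (simp add: integral_nonneg)
    also have "\<dots> = (\<Sum>t<n. ?c t) / real n"
      using ne by (simp add: integral_pmf_of_set)
    also have "(\<Sum>t<n. ?c t) = (\<Sum>t\<in>S. ?c t) + (\<Sum>t\<in>{..<n} - S. ?c t)"
      using Suc.prems by (simp add: sum.subset_diff[of S "{..<n}"] add.commute)
    also have "(\<Sum>t\<in>S. ?c t) = (\<Sum>t\<in>S. cover_prob n j m)"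
      using fin Suc by (intro sum.cong) auto
    also have "\<dots> = real (Suc j) * cover_prob n j m" using Suc by simp
    also have "(\<Sum>t\<in>{..<n} - S. ?c t) = (\<Sum>t\<in>{..<n} - S. cover_prob n (Suc j) m)"
      using Suc by (intro sum.cong) auto
    also have "\<dots> = (real n - real (Suc j)) * cover_prob n (Suc j) m"
      using Suc fin jn Suc.prems by (simp add: card_Diff_subset of_nat_diff)
    finally show ?thesis unfolding Suc cover_prob.simps using assms(2)
      by (simp add: add_divide_distrib diff_divide_distrib left_diff_distrib del: of_nat_Suc)
  qed
qed

lemma coupon_T_measurable [measurable]: "coupon_T n \<in> measurable (draws n) (count_space UNIV)"
  unfolding coupon_T_def[abs_def] by measurable

text \<open>Needed because the \<open>LEAST\<close> in \<open>coupon_T\<close> has an unspecified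
  value on streams that never show all coupons. The covering probabilities bound the event from
  below and tend to 1.\<close>

lemma AE_all_covered:
  assumes "0 < n"
  shows "AE \<omega> in draws n. \<exists>m. {..<n} \<subseteq> set (stake m \<omega>)"
proof -
  interpret prob_space "draws n" by (rule prob_space_draws)
  have [measurable]: "Measurable.pred (draws n) (\<lambda>\<omega>. \<exists>m. {..<n} \<subseteq> set (stake m \<omega>))" by measurable
  let ?A = "{\<omega>. \<exists>m. {..<n} \<subseteq> set (stake m \<omega>)}"
  have A: "?A \<in> sets (draws n)"
    using \<open>Measurable.pred _ _\<close> by (simp add: pred_def)
  have "cover_prob n n m \<le> prob ?A" for m
  proof -
    have "prob {\<omega>. {..<n} \<subseteq> set (stake m \<omega>)} \<le> prob ?A"
      by (intro finite_measure_mono A) auto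
    then show ?thesis using measure_covered[of "{..<n}" n m] assms by simp
  qed
  then have "1 \<le> prob ?A"
    by (intro LIMSEQ_le_const2[OF cover_prob_tendsto_1[of n n]]) (use assms in auto)
  then have "prob ?A = 1" using prob_le_1[of ?A] by simp
  then show ?thesis using prob_eq_1[OF A] by simp
qed

text \<open>The increments of \<open>cover_prob n n\<close> are the point masses of the completion
  time. The limit of partial sums comes from dominated convergence.\<close>

lemma coupon_T_expectation:
  fixes \<phi> :: "nat \<Rightarrow> real"
  assumes n: "0 < n" and bounded: "\<And>m. \<bar>\<phi> m\<bar> \<le> B"
  shows "(\<lambda>N. \<Sum>m<N. \<phi> (Suc m) * (cover_prob n n (Suc m) - cover_prob n n m))
    \<longlonglongrightarrow> (\<integral>\<omega>. \<phi> (coupon_T n \<omega>) \<partial>draws n)"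
proof -
  interpret prob_space "draws n" by (rule prob_space_draws)
  define A where "A m = {\<omega>. {..<n} \<subseteq> set (stake m \<omega>)}" for m
  have A [measurable]: "A m \<in> events" for m
    using pred_covered[where n = n and S = "{..<n}" and m = m] by (simp add: A_def pred_def)
  \<comment> \<open>Where covering occurs, \<open>s N\<close> is \<open>\<phi>\<close> of the
    completion time cut off after \<open>N\<close>. Written through the events \<open>A m\<close>,
    its expectation involves covering probabilities only.\<close>
  define s where "s N \<omega> = (\<Sum>m<N. \<phi> (Suc m) * (indicator (A (Suc m)) \<omega> - indicator (A m) \<omega>))" for N \<omega>
  have A_iff: "\<omega> \<in> A m \<longleftrightarrow> coupon_T n \<omega> \<le> m" if ex: "\<omega> \<in> A k" for \<omega> m k
  proof
    assume "\<omega> \<in> A m"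
    then show "coupon_T n \<omega> \<le> m" unfolding A_def coupon_T_def by (auto intro: Least_le)
  next
    assume le: "coupon_T n \<omega> \<le> m"
    have "{..<n} \<subseteq> set (stake (coupon_T n \<omega>) \<omega>)"
      unfolding coupon_T_def using ex LeastI[of "\<lambda>m. {..<n} \<subseteq> set (stake m \<omega>)" k] by (simp add: A_def)
    also have "\<dots> \<subseteq> set (stake m \<omega>)"
      using set_take_subset[of "coupon_T n \<omega>" "stake m \<omega>"] le by (simp add: take_stake min_absorb1)
    finally show "\<omega> \<in> A m" by (simp add: A_def)
  qed
  have s_eq: "s N \<omega> = (if 1 \<le> coupon_T n \<omega> \<and> coupon_T n \<omega> \<le> N then \<phi> (coupon_T n \<omega>) else 0)"
    if "\<omega> \<in> A k" for N \<omega> k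
  proof -
    have ind: "indicator (A m) \<omega> = (if coupon_T n \<omega> \<le> m then 1 else 0 :: real)" for m
      using A_iff[OF that, of m] by simp
    have "s N \<omega> = (\<Sum>m<N. if m = coupon_T n \<omega> - 1 \<and> 1 \<le> coupon_T n \<omega> then \<phi> (coupon_T n \<omega>) else 0)"
      unfolding s_def ind by (intro sum.cong) (auto simp: le_Suc_eq)
    then show ?thesis by (cases "1 \<le> coupon_T n \<omega>") (auto simp: sum.delta)
  qed
  have s_0: "s N \<omega> = 0" if "\<And>k. \<omega> \<notin> A k" for N \<omega>
    using that by (simp add: s_def)
  have B: "0 \<le> B" using bounded[of 0] by linarith
  \<comment> \<open>Since \<open>0 < n\<close>, no draws cover nothing, so the sum starting at
    \<open>\<phi> 1\<close> misses no mass.\<close>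
  have T_pos: "1 \<le> coupon_T n \<omega>" if "\<omega> \<in> A k" for \<omega> k
    using A_iff[OF that, of 0] n by (cases "coupon_T n \<omega>") (auto simp: A_def split: if_splits)
  have [measurable]: "s N \<in> borel_measurable (draws n)" for N
    unfolding s_def[abs_def] by measurable
  have "(\<lambda>N. \<integral>\<omega>. s N \<omega> \<partial>draws n) \<longlonglongrightarrow> (\<integral>\<omega>. \<phi> (coupon_T n \<omega>) \<partial>draws n)"
  proof (rule integral_dominated_convergence)
    show "(\<lambda>\<omega>. \<phi> (coupon_T n \<omega>)) \<in> borel_measurable (draws n)" by measurable
    show "integrable (draws n) (\<lambda>\<omega>. B)" by simp
    show "AE \<omega> in draws n. (\<lambda>N. s N \<omega>) \<longlonglongrightarrow> \<phi> (coupon_T n \<omega>)"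
      using AE_all_covered[OF n]
    proof eventually_elim
      case (elim \<omega>)
      then obtain k where k: "\<omega> \<in> A k" by (auto simp: A_def)
      have "\<forall>\<^sub>F N in sequentially. s N \<omega> = \<phi> (coupon_T n \<omega>)"
        using eventually_ge_at_top[of "coupon_T n \<omega>"]
        by eventually_elim (use s_eq[OF k] T_pos[OF k] in auto)
      then show ?case by (rule tendsto_eventually)
    qed
    show "AE \<omega> in draws n. norm (s N \<omega>) \<le> B" for N
    proof (rule AE_I2)
      fix \<omega>
      show "norm (s N \<omega>) \<le> B"
        using s_eq[of \<omega> _ N] s_0[of \<omega> N] bounded B by (cases "\<exists>k. \<omega> \<in> A k") auto
    qed
  qed simp
  moreover have "(\<integral>\<omega>. s N \<omega> \<partial>draws n) =
      (\<Sum>m<N. \<phi> (Suc m) * (cover_prob n n (Suc m) - cover_prob n n m))" for N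
  proof -
    have "prob (A m) = cover_prob n n m" for m
      using measure_covered[of "{..<n}" n m] n by (simp add: A_def)
    then show ?thesis unfolding s_def
      by (simp add: Bochner_Integration.integral_sum Bochner_Integration.integral_diff
          integrable_real_indicator less_top[symmetric])
  qed
  ultimately show ?thesis by simp
qed

section \<open>The semigroup and its generator\<close>

lemma gumbel_density_measurable [measurable]: "gumbel_density \<in> borel_measurable borel"
  unfolding gumbel_density_def[abs_def] by measurable

lemma gumbel_density_nonneg [simp]: "0 \<le> gumbel_density x"
  by (simp add: gumbel_density_def)

lemma space_gumbel [simp]: "space gumbel = UNIV"
  and sets_gumbel [simp, measurable_cong]: "sets gumbel = sets borel"
  by (simp_all add: gumbel_def)

text \<open>The reflection \<open>x\<close> to \<open>- x\<close> moves the half-line to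
  \<open>{- c ..}\<close>, where the integrand is the derivative of
  \<open>- exp (- exp x)\<close>.\<close>

lemma emeasure_gumbel_atMost: "emeasure gumbel {..c} = ennreal (exp (- exp (- c)))"
proof -
  let ?f = "\<lambda>x::real. exp x * exp (- exp x)"
  have "emeasure gumbel {..c} = (\<integral>\<^sup>+x. ennreal (gumbel_density x) * indicator {..c} x \<partial>lborel)"
    unfolding gumbel_def by (subst emeasure_density) auto
  also have "\<dots> = (\<integral>\<^sup>+x. ennreal (gumbel_density (- x)) * indicator {..c} (- x) \<partial>lborel)"
    by (subst nn_integral_real_affine[where c = "-1" and t = 0]) auto
  also have "\<dots> = (\<integral>\<^sup>+x. ennreal (?f x) * indicator {- c ..} x \<partial>lborel)"
    by (intro nn_integral_cong)
       (auto simp: gumbel_density_def exp_add[symmetric] exp_diff exp_minus divide_inverse split: split_indicator)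
  also have "\<dots> = ennreal (0 - (- exp (- exp (- c))))"
  proof (rule nn_integral_FTC_atLeast)
    show "((\<lambda>x. - exp (- exp x)) has_real_derivative ?f x) (at x)" for x :: real
      by (auto intro!: derivative_eq_intros)
    have "((\<lambda>x::real. exp (- exp x)) \<longlongrightarrow> 0) at_top"
      by (intro filterlim_compose[OF exp_at_bot]
          filterlim_compose[OF filterlim_uminus_at_bot_at_top] exp_at_top)
    from tendsto_minus[OF this] show "((\<lambda>x::real. - exp (- exp x)) \<longlongrightarrow> 0) at_top" by simp
  qed auto
  finally show ?thesis by simp
qed

lemma gumbel_le_exp: "gumbel_density x \<le> exp (- x)"
  by (simp add: gumbel_density_def)

lemma finite_measure_gumbel: "finite_measure gumbel"
proof
  have "emeasure gumbel {0..} = (\<integral>\<^sup>+x. ennreal (gumbel_density x) * indicator {0..} x \<partial>lborel)"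
    unfolding gumbel_def by (subst emeasure_density) auto
  also have "\<dots> \<le> (\<integral>\<^sup>+x. ennreal (exp (- x)) * indicator {0..} x \<partial>lborel)"
    by (intro nn_integral_mono mult_right_mono ennreal_leI gumbel_le_exp) auto
  also have "\<dots> = ennreal (0 - (- exp (- 0)))"
  proof (rule nn_integral_FTC_atLeast)
    show "((\<lambda>x. - exp (- x)) has_real_derivative exp (- x)) (at x)" for x :: real
      by (auto intro!: derivative_eq_intros)
    have "((\<lambda>x::real. exp (- x)) \<longlongrightarrow> 0) at_top"
      by (intro filterlim_compose[OF exp_at_bot] filterlim_uminus_at_bot_at_top)
    from tendsto_minus[OF this] show "((\<lambda>x::real. - exp (- x)) \<longlongrightarrow> 0) at_top" by simp
  qed auto
  finally have "emeasure gumbel {0..} < \<infinity>" by (simp add: le_less_trans)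
  moreover have "emeasure gumbel {..0} < \<infinity>" by (simp add: emeasure_gumbel_atMost)
  moreover have "emeasure gumbel (space gumbel) \<le> emeasure gumbel {..0} + emeasure gumbel {0..}"
    by (rule order_trans[OF _ emeasure_subadditive]) (auto intro!: emeasure_mono)
  ultimately show "emeasure gumbel (space gumbel) \<noteq> \<infinity>"
    by (metis ennreal_add_less_top infinity_ennreal_def less_irrefl order_le_less_trans)
qed

lemma AE_gumbel_neq: "AE z in gumbel. z \<noteq> c"
  unfolding gumbel_def by (subst AE_density) (auto intro: AE_mp[OF AE_lborel_singleton])

lemma measure_gumbel_lessThan: "measure gumbel {..<c} = exp (- exp (- c))"
proof -
  interpret finite_measure gumbel by (rule finite_measure_gumbel)
  have "measure gumbel {..<c} = measure gumbel {..c}"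
    by (intro finite_measure_eq_AE) (use AE_gumbel_neq[of c] in \<open>auto elim!: eventually_mono\<close>)
  then show ?thesis by (simp add: measure_def emeasure_gumbel_atMost)
qed

lemma integrable_erlang_density: "0 < l \<Longrightarrow> integrable lborel (erlang_density k l)"
  using nn_integral_erlang_ith_moment[of l k 0]
  by (intro integrableI_nonneg) (auto simp: ennreal_less_top)

text \<open>Makes \<open>h (max b (z + a))\<close> integrable for Lipschitz \<open>h\<close>: it is
  constant for small \<open>z\<close> and grows at most linearly. The majorant is a shifted Erlang
  density.\<close>

lemma integrable_gumbel_excess: "integrable gumbel (\<lambda>z. max 0 (z - c))"
proof -
  have "integrable lborel (\<lambda>z. exp (- c) * erlang_density 1 1 (- c + 1 * z))"
    by (intro integrable_mult_right lborel_integrable_real_affine integrable_erlang_density) auto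
  then have "integrable lborel (\<lambda>z. gumbel_density z * max 0 (z - c))"
  proof (rule Bochner_Integration.integrable_bound)
    have "gumbel_density z * (z - c) \<le> exp (- c) * ((z - c) * exp (- (z - c)))" if "c \<le> z" for z
    proof -
      have "gumbel_density z * (z - c) \<le> exp (- z) * (z - c)"
        using that by (intro mult_right_mono gumbel_le_exp) auto
      also have "\<dots> = exp (- c) * ((z - c) * exp (- (z - c)))"
        by (simp add: exp_add[symmetric] mult_ac exp_diff exp_minus field_simps)
      finally show ?thesis .
    qed
    then show "AE z in lborel. norm (gumbel_density z * max 0 (z - c))
        \<le> norm (exp (- c) * erlang_density 1 1 (- c + 1 * z))"
      by (intro AE_I2) (auto simp: erlang_density_def max_def)
  qed measurable
  then show ?thesis unfolding gumbel_def by (subst integrable_density) auto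
qed

section \<open>Derivative of the semigroup\<close>

text \<open>The integrand depends on \<open>x\<close> only where \<open>x - t\<close> wins the
  maximum, that is for \<open>z < c\<close>; there its derivative is \<open>h' (x - t)\<close>. The
  exponential factor is the Gumbel probability of this event.\<close>

lemma deriv_P0:
  assumes h': "\<And>x. (h has_real_derivative h' x) (at x)"
    and lip: "\<And>x y. \<bar>h x - h y\<bar> \<le> B * \<bar>x - y\<bar>" and t: "0 < t"
  shows "deriv (P0 t h) x = h' (x - t) * exp (- (gamma_t t * exp (- x)))"
proof (rule DERIV_imp_deriv)
  interpret finite_measure gumbel by (rule finite_measure_gumbel)
  define a where "a = ln (1 - exp (- t))"
  have B: "0 \<le> B" using lip[of 0 1] by (simp add: order_trans[OF abs_ge_zero])
  have cont: "continuous_on UNIV h"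
    using h' by (auto intro!: DERIV_continuous_on simp: has_field_derivative_at_within)
  then have [measurable]: "h \<in> borel_measurable borel" by (rule borel_measurable_continuous_onI)
  have intg: "integrable gumbel (\<lambda>z. h (max b (z + a)))" for b
  proof (rule Bochner_Integration.integrable_bound)
    show "integrable gumbel (\<lambda>z. \<bar>h b\<bar> + B * max 0 (z - (b - a)))"
      by (intro Bochner_Integration.integrable_add integrable_mult_right integrable_gumbel_excess) simp
    have "\<bar>h (max b (z + a))\<bar> \<le> \<bar>h b\<bar> + B * max 0 (z - (b - a))" for z
    proof -
      have eq: "\<bar>max b (z + a) - b\<bar> = max 0 (z - (b - a))" by (auto simp: max_def)
      show ?thesis using lip[of "max b (z + a)" b] unfolding eq by linarith
    qed
    then show "AE z in gumbel. norm (h (max b (z + a))) \<le> norm (\<bar>h b\<bar> + B * max 0 (z - (b - a)))"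
      by (intro AE_I2) (smt (verit) real_norm_def)
  qed measurable
  \<comment> \<open>The value of \<open>z\<close> at which both arguments of the maximum agree; this
    kink is a null set.\<close>
  define c where "c = x - t - a"
  have lim: "((\<lambda>\<epsilon>. (P0 t h (x + \<epsilon>) - P0 t h x) / \<epsilon>) \<longlongrightarrow> (\<integral>z. indicator {..<c} z * h' (x - t) \<partial>gumbel)) (at 0)"
    unfolding tendsto_at_iff_sequentially
  proof (intro allI impI)
    fix X :: "nat \<Rightarrow> real" assume X: "\<forall>i. X i \<in> UNIV - {0}" "X \<longlonglongrightarrow> 0"
    let ?q = "\<lambda>i z. (h (max (x + X i - t) (z + a)) - h (max (x - t) (z + a))) / X i"
    have "(\<lambda>i. \<integral>z. ?q i z \<partial>gumbel) \<longlonglongrightarrow> (\<integral>z. indicator {..<c} z * h' (x - t) \<partial>gumbel)"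
    proof (rule integral_dominated_convergence)
      show "integrable gumbel (\<lambda>z. B)" by simp
      show "AE z in gumbel. norm (?q i z) \<le> B" for i
      proof (rule AE_I2)
        fix z
        \<comment> \<open>The maximum is 1-Lipschitz in its first argument, so the difference
          quotients are dominated by the constant \<open>B\<close>.\<close>
        have "\<bar>h (max (x + X i - t) (z + a)) - h (max (x - t) (z + a))\<bar>
            \<le> B * \<bar>max (x + X i - t) (z + a) - max (x - t) (z + a)\<bar>" by (rule lip)
        also have "\<dots> \<le> B * \<bar>X i\<bar>" using B by (intro mult_left_mono) auto
        finally show "norm (?q i z) \<le> B" using X(1) by (simp add: divide_le_eq)
      qed
      show "AE z in gumbel. (\<lambda>i. ?q i z) \<longlonglongrightarrow> indicator {..<c} z * h' (x - t)"
        using AE_gumbel_neq[of c]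
      proof eventually_elim
        case (elim z)
        show ?case
        proof (cases "z < c")
          case True
          have "\<forall>\<^sub>F i in sequentially. c - z > - X i"
            by (rule order_tendstoD[OF tendsto_minus[OF X(2)]]) (use True in simp)
          then have "\<forall>\<^sub>F i in sequentially. (h (x - t + X i) - h (x - t)) / X i = ?q i z"
            by eventually_elim (use True in \<open>simp add: c_def max_def algebra_simps\<close>)
          moreover have "(\<lambda>i. (h (x - t + X i) - h (x - t)) / X i) \<longlonglongrightarrow> h' (x - t)"
            using h'[of "x - t"] X unfolding DERIV_def tendsto_at_iff_sequentially comp_def by auto
          ultimately show ?thesis using True by (auto intro: Lim_transform_eventually)
        next
          case False
          then have "c < z" using elim by simp
          have "\<forall>\<^sub>F i in sequentially. X i < z - c"
            by (rule order_tendstoD[OF X(2)]) (use \<open>c < z\<close> in simp)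
          then have "\<forall>\<^sub>F i in sequentially. ?q i z = 0"
            by eventually_elim (use \<open>c < z\<close> in \<open>simp add: c_def max_def\<close>)
          then show ?thesis using False by (auto intro: tendsto_eventually)
        qed
      qed
    qed measurable
    moreover have "(P0 t h (x + X i) - P0 t h x) / X i = (\<integral>z. ?q i z \<partial>gumbel)" for i
      using intg unfolding P0_def a_def[symmetric] by simp
    ultimately show "((\<lambda>\<epsilon>. (P0 t h (x + \<epsilon>) - P0 t h x) / \<epsilon>) \<circ> X)
        \<longlonglongrightarrow> (\<integral>z. indicator {..<c} z * h' (x - t) \<partial>gumbel)"
      by (simp only: comp_def)
  qed
  have val: "(\<integral>z. indicator {..<c} z * h' (x - t) \<partial>gumbel) = exp (- exp (- c)) * h' (x - t)"
    by (simp add: measure_gumbel_lessThan)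
  have ec: "exp (- c) = gamma_t t * exp (- x)"
  proof -
    have "exp (- c) = exp (- x) * (exp t * exp a)" unfolding c_def by (simp add: exp_add[symmetric])
    also have "exp a = 1 - exp (- t)" unfolding a_def using t by simp
    also have "exp t * (1 - exp (- t)) = gamma_t t"
      by (simp add: gamma_t_def right_diff_distrib exp_add[symmetric])
    finally show ?thesis by simp
  qed
  show "(P0 t h has_real_derivative h' (x - t) * exp (- (gamma_t t * exp (- x)))) (at x)"
    using lim unfolding DERIV_def val ec by (simp only: mult.commute)
qed

section \<open>Exponential averages as tail integrals\<close>

text \<open>Near \<open>x\<close> the tail integral is a constant minus an integral over
  \<open>{x - 1..y}\<close>, to which the fundamental theorem on a compact interval applies.\<close>

lemma has_derivative_tail_integral:
  fixes \<phi> :: "real \<Rightarrow> real"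
  assumes cont: "continuous_on UNIV \<phi>" and int: "\<And>a. set_integrable lborel {a..} \<phi>"
  shows "((\<lambda>x. LINT u:{x..}|lborel. \<phi> u) has_real_derivative - \<phi> x) (at x)"
proof -
  let ?a = "x - 1" and ?b = "x + 1"
  let ?H = "\<lambda>x. LINT u:{x..}|lborel. \<phi> u"
  have eq: "?H y = ?H ?a - integral {?a..y} \<phi>" if "y \<in> {?a..?b}" for y
  proof -
    have fin: "set_integrable lborel {?a..y} \<phi>" using int[of ?a] by (rule set_integrable_subset) auto
    have "?H ?a = (LINT u:{?a..y} \<union> {y..}|lborel. \<phi> u)"
      using that by (intro arg_cong2[where f = "\<lambda>A f. set_lebesgue_integral lborel A f"]) auto
    also have "\<dots> = (LINT u:{?a..y}|lborel. \<phi> u) + ?H y"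
      by (intro set_integral_Un_AE fin int) (auto intro: AE_mp[OF AE_lborel_singleton[of y]])
    finally show ?thesis using set_borel_integral_eq_integral(2)[OF fin] by simp
  qed
  have "((\<lambda>y. ?H ?a - integral {?a..y} \<phi>) has_real_derivative 0 - \<phi> x) (at x within {?a..?b})"
    by (intro DERIV_diff DERIV_const integral_has_real_derivative continuous_on_subset[OF cont]) auto
  then have "(?H has_real_derivative 0 - \<phi> x) (at x within {?a..?b})"
    by (rule has_field_derivative_transform_within[where d = 1]) (auto intro: eq[symmetric])
  then show ?thesis by (simp add: at_within_Icc_at)
qed

lemma expo1_tail_integral:
  fixes g :: "real \<Rightarrow> real"
  assumes [measurable]: "g \<in> borel_measurable borel"
  shows "exp (- x) * (\<integral>y. g (x + y) \<partial>expo1) = (LINT u:{x..}|lborel. exp (- u) * g u)"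
proof -
  have "(\<integral>y. g (x + y) \<partial>expo1) = (\<integral>y. exponential_density 1 y * g (x + y) \<partial>lborel)"
    unfolding expo1_def by (subst integral_density) auto
  also have "\<dots> = (\<integral>u. exponential_density 1 (- x + 1 * u) * g (x + (- x + 1 * u)) \<partial>lborel)"
    by (subst lborel_integral_real_affine[where c = 1 and t = "- x"]) auto
  finally have "exp (- x) * (\<integral>y. g (x + y) \<partial>expo1)
    = (\<integral>u. exp (- x) * (exponential_density 1 (- x + 1 * u) * g (x + (- x + 1 * u))) \<partial>lborel)" by simp
  also have "\<dots> = (LINT u:{x..}|lborel. exp (- u) * g u)"
    unfolding set_lebesgue_integral_def
    by (intro Bochner_Integration.integral_cong)
       (auto simp: exponential_density_def exp_diff exp_minus field_simps split: split_indicator)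
  finally show ?thesis .
qed

text \<open>\<open>H\<close> is the nonlocal part of the generator. The derivative formula gives its
  increments by the mean value theorem; the bound controls the boundary term of the summation by
  parts.\<close>

lemma expo1_average:
  fixes g :: "real \<Rightarrow> real"
  assumes cont: "continuous_on UNIV g" and bound: "\<And>x. \<bar>g x\<bar> \<le> M"
  defines "H \<equiv> \<lambda>x. exp (- x) * (\<integral>y. g (x + y) \<partial>expo1)"
  shows "(H has_real_derivative - (g x * exp (- x))) (at x)" and "\<bar>H x\<bar> \<le> M * exp (- x)"
proof -
  have [measurable]: "g \<in> borel_measurable borel"
    using cont by (rule borel_measurable_continuous_onI)
  have int: "set_integrable lborel {a..} (\<lambda>u. exp (- u) * g u)" for a
    unfolding set_integrable_def
  proof (rule Bochner_Integration.integrable_bound)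
    show "integrable lborel (\<lambda>u. (M * exp (- a)) * exponential_density 1 (- a + 1 * u))"
      by (intro integrable_mult_right lborel_integrable_real_affine integrable_erlang_density) auto
    show "AE u in lborel. norm (indicat_real {a..} u *\<^sub>R (exp (- u) * g u))
        \<le> norm ((M * exp (- a)) * exponential_density 1 (- a + 1 * u))"
    proof (rule AE_I2)
      fix u
      have "exp (- u) * \<bar>g u\<bar> \<le> exp (- u) * M" using bound by (intro mult_left_mono) auto
      then show "norm (indicat_real {a..} u *\<^sub>R (exp (- u) * g u))
        \<le> norm ((M * exp (- a)) * exponential_density 1 (- a + 1 * u))"
        using order_trans[OF abs_ge_zero bound[of 0]]
        by (auto simp: exponential_density_def abs_mult exp_diff exp_minus field_simps split: split_indicator)
    qed
  qed measurable
  have "H = (\<lambda>x. LINT u:{x..}|lborel. exp (- u) * g u)"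
    unfolding H_def by (intro ext expo1_tail_integral) simp
  moreover have "((\<lambda>x. LINT u:{x..}|lborel. exp (- u) * g u) has_real_derivative - (exp (- x) * g x)) (at x)"
    by (intro has_derivative_tail_integral int continuous_intros cont)
  ultimately show "(H has_real_derivative - (g x * exp (- x))) (at x)" by (simp add: mult.commute)
  interpret prob_space expo1 unfolding expo1_def by (rule prob_space_exponential_density) simp
  have "\<bar>\<integral>y. g (x + y) \<partial>expo1\<bar> \<le> M"
  proof -
    have [measurable_cong]: "sets expo1 = sets borel" by (simp add: expo1_def)
    have ig: "integrable expo1 (\<lambda>y. g (x + y))"
      by (rule integrable_const_bound[where B = M]) (use bound in auto)
    have "norm (\<integral>y. g (x + y) \<partial>expo1) \<le> (\<integral>y. norm (g (x + y)) \<partial>expo1)"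
      by (rule integral_norm_bound)
    also have "\<dots> \<le> (\<integral>y. M \<partial>expo1)"
      by (intro integral_mono integrable_norm ig) (use bound in auto)
    finally show ?thesis by (simp add: prob_space)
  qed
  then show "\<bar>H x\<bar> \<le> M * exp (- x)"
    unfolding H_def by (simp add: abs_mult mult.commute)
qed

lemma L0_P0_decomposition:
  assumes h': "\<And>x. (h has_real_derivative h' x) (at x)"
    and lip: "\<And>x y. \<bar>h x - h y\<bar> \<le> B * \<bar>x - y\<bar>" and t: "0 < t"
  shows "L0 (P0 t h) x = exp (- x) * (\<integral>y. h' (x + y - t) * exp (- (gamma_t t * exp (- (x + y)))) \<partial>expo1)
    - h' (x - t) * exp (- (gamma_t t * exp (- x)))"
  unfolding L0_def using deriv_P0[OF assms] by simp

section \<open>Discretisation errors\<close>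

text \<open>Fourth power of \<open>(1 + s) / 8 \<le> exp (s / 8)\<close>, with 4096 = 8^4.\<close>

lemma exp_half_bound:
  fixes s :: real
  assumes "0 \<le> s"
  shows "exp (- s / 2) \<le> 4096 / (1 + s) ^ 4"
proof -
  have "(1 + s) / 8 \<le> exp (s / 8)" using exp_ge_add_one_self[of "s / 8"]
    unfolding add_divide_distrib by linarith
  then have "((1 + s) / 8) ^ 4 \<le> exp (s / 8) ^ 4" using assms by (intro power_mono) auto
  also have "\<dots> = exp (s / 2)" by (simp add: exp_of_nat_mult[symmetric])
  finally have "(1 + s) ^ 4 \<le> 4096 * exp (s / 2)" by (simp add: power_divide)
  then show ?thesis using assms by (simp add: exp_minus field_simps)
qed

text \<open>Here \<open>w\<close> is the square root of the scale s. The logarithm is at most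
  \<open>2 / w\<close>, which costs half a power of s near 0, hence the numerator \<open>w\<close>;
  for large \<open>w\<close> the exponential beats all powers. The constant is 6 * 4096.\<close>

lemma log_weight_bound:
  fixes w A :: real
  assumes w: "0 < w" and A: "0 \<le> A"
  shows "w\<^sup>2 * exp (- w\<^sup>2 / 2) * (1 + w\<^sup>2 + (A - ln (w\<^sup>2))) \<le> 24576 * (1 + A) * (w / (1 + w)\<^sup>2)"
proof -
  let ?s = "w\<^sup>2"
  have s: "0 < ?s" using w by simp
  have "ln (1 / w) \<le> 1 / w - 1" using w by (intro ln_le_minus_one) simp
  then have "- ln ?s \<le> 2 / w" using w by (simp add: ln_realpow ln_div)
  then have "1 + ?s + (A - ln ?s) \<le> (1 + A) + 1 * ?s + 1 * (2 / w)" by simp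
  also have "\<dots> \<le> (1 + A) + (1 + A) * ?s + (1 + A) * (2 / w)"
    using A w by (intro add_mono mult_right_mono) auto
  finally have 1: "1 + ?s + (A - ln ?s) \<le> (1 + A) * (1 + ?s + 2 / w)" by (simp add: algebra_simps)
  have "?s * exp (- ?s / 2) * (1 + ?s + (A - ln ?s))
      \<le> ?s * exp (- ?s / 2) * ((1 + A) * (1 + ?s + 2 / w))"
    using s by (intro mult_left_mono 1) auto
  also have "\<dots> \<le> ?s * (4096 / (1 + ?s) ^ 4) * ((1 + A) * (1 + ?s + 2 / w))"
    using s A w by (intro mult_right_mono mult_left_mono exp_half_bound) auto
  also have "\<dots> = 4096 * (1 + A) * (w * (w * (1 + ?s) + 2) / (1 + ?s) ^ 4)"
  proof -
    have "?s * (1 + ?s + 2 / w) = w * (w * (1 + ?s) + 2)"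
      using w by (simp add: power2_eq_square algebra_simps)
    moreover have "?s * (4096 / X) * (B * Y) = 4096 * B * (?s * Y / X)" for X B Y :: real by simp
    ultimately show ?thesis by metis
  qed
  also have "\<dots> \<le> 4096 * (1 + A) * (6 * (w / (1 + w)\<^sup>2))"
  proof (intro mult_left_mono)
    have a: "(1 + w)\<^sup>2 \<le> 2 * (1 + ?s)"
      using sum_squares_bound[of 1 w] by (simp add: power2_eq_square algebra_simps)
    have "w \<le> 1 + ?s" using sum_squares_bound[of 1 w] s w by (simp add: power2_eq_square)
    then have "w * (1 + ?s) \<le> (1 + ?s)\<^sup>2" using s by (simp add: power2_eq_square mult_right_mono)
    moreover have "1 \<le> (1 + ?s)\<^sup>2" using s by (simp add: one_le_power)
    ultimately have b: "w * (1 + ?s) + 2 \<le> 3 * (1 + ?s)\<^sup>2" by linarith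
    have "(w * (1 + ?s) + 2) * (1 + w)\<^sup>2 \<le> (3 * (1 + ?s)\<^sup>2) * (2 * (1 + ?s))"
      using a b w s by (intro mult_mono) auto
    also have "\<dots> = 6 * (1 + ?s) ^ 3" by (simp add: power2_eq_square power3_eq_cube)
    also have "\<dots> \<le> 6 * (1 + ?s) ^ 4" using s by (intro mult_left_mono power_increasing) auto
    finally have "w * ((w * (1 + ?s) + 2) * (1 + w)\<^sup>2) \<le> w * (6 * (1 + ?s) ^ 4)"
      using w by (intro mult_left_mono) auto
    moreover have "0 < 1 + ?s" using s by linarith
    moreover from this have "0 < (1 + ?s) ^ 4" "0 < (1 + w)\<^sup>2" using w by auto
    ultimately show "w * (w * (1 + ?s) + 2) / (1 + ?s) ^ 4 \<le> 6 * (w / (1 + w)\<^sup>2)"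
      by (simp add: divide_simps mult_ac)
  qed (use A in auto)
  finally show ?thesis by (simp add: mult_ac)
qed

text \<open>The summands of the Riemann sum error are dominated by increments of the bounded function \<open>w / (1 + w)\<close>,
  so that their sum telescopes.\<close>
lemma log_scale_step:
  fixes w r n :: real
  assumes w: "0 < w" and n: "1 \<le> n" and r: "r = exp (- (1 / (2 * n)))"
  shows "w / (1 + w)\<^sup>2 / n \<le> 3 * (w / (1 + w) - r * w / (1 + r * w))"
proof -
  have r0: "0 < r" "r \<le> 1" unfolding r using n by auto
  have "1 + 1 / (2 * n) \<le> exp (1 / (2 * n))" by (rule exp_ge_add_one_self)
  then have "r \<le> 1 / (1 + 1 / (2 * n))"
    unfolding r exp_minus inverse_eq_divide using n by (intro divide_left_mono mult_pos_pos add_pos_pos) auto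
  \<comment> \<open>The left side is \<open>1 - 1 / (2 * n + 1)\<close>, and
    \<open>2 * n + 1 \<le> 3 * n\<close>; this is the source of the factor 3.\<close>
  also have "\<dots> \<le> 1 - 1 / (3 * n)" using n by (simp add: field_simps)
  finally have "1 / n \<le> 3 * (1 - r)" using n by (simp add: field_simps)
  then have "w / (1 + w)\<^sup>2 * (1 / n) \<le> w / (1 + w)\<^sup>2 * (3 * (1 - r))"
    using w by (intro mult_left_mono) auto
  also have "\<dots> = 3 * (w * (1 - r) / ((1 + w) * (1 + w)))" by (simp add: power2_eq_square)
  also have "\<dots> \<le> 3 * (w * (1 - r) / ((1 + w) * (1 + r * w)))"
    using w r0 by (intro mult_left_mono divide_left_mono mult_pos_pos add_pos_pos) auto
  also have "w * (1 - r) / ((1 + w) * (1 + r * w)) = w / (1 + w) - r * w / (1 + r * w)"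
  proof -
    have "1 + w \<noteq> 0" "1 + r * w \<noteq> 0" using w r0 by (auto simp: add_pos_pos intro!: less_imp_neq[symmetric])
    then show ?thesis by (simp add: diff_frac_eq algebra_simps)
  qed
  finally show ?thesis by simp
qed

text \<open>Since \<open>x / (1 + x)\<close> lies between 0 and 1 for positive \<open>x\<close>, the
  telescoped bound is uniform in \<open>a\<close>, \<open>n\<close> and \<open>N\<close>.\<close>

lemma sum_log_scale_le:
  fixes a n :: real
  assumes a: "0 < a" and n: "1 \<le> n"
  defines "w \<equiv> \<lambda>m. a * exp (- (1 / (2 * n))) ^ m"
  shows "(\<Sum>m<N. w m / (1 + w m)\<^sup>2 / n) \<le> 3"
proof -
  let ?r = "exp (- (1 / (2 * n)))"
  let ?P = "\<lambda>x. x / (1 + x)"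
  have w: "0 < w m" "w (Suc m) = ?r * w m" for m using a by (auto simp: w_def)
  have "(\<Sum>m<N. w m / (1 + w m)\<^sup>2 / n) \<le> (\<Sum>m<N. 3 * (?P (w m) - ?P (w (Suc m))))"
    unfolding w(2) by (intro sum_mono log_scale_step w n refl)
  also have "\<dots> = 3 * (?P (w 0) - ?P (w N))"
    unfolding sum_distrib_left[symmetric] sum_lessThan_telescope'[of "\<lambda>m. ?P (w m)"] ..
  also have "\<dots> \<le> 3 * (1 - 0)"
    using w(1)[of 0] w(1)[of N] by (intro mult_left_mono diff_mono) auto
  finally show ?thesis by simp
qed

lemma x_exp_minus_le:
  fixes c x :: real
  assumes "0 < c" "0 \<le> x"
  shows "exp (- (c * x)) * x \<le> 1 / c"
proof -
  have "c * x \<le> exp (c * x)" using exp_ge_add_one_self[of "c * x"] by linarith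
  then show ?thesis using assms by (simp add: exp_minus field_simps)
qed

section \<open>Error in one cell of the Riemann sum\<close>

text \<open>Three errors of order \<open>1 / n\<close> add up: the variation of \<open>k\<close>
  gives \<open>L\<close>, that of \<open>exp (- (c * exp (- x)))\<close> gives \<open>c * y\<close>,
  and replacing \<open>exp (- u)\<close> by \<open>y * r\<close> gives
  \<open>1 + \<mu>\<close>.\<close>

lemma gumbel_weight_step:
  fixes k :: "real \<Rightarrow> real" and c n x u r y \<mu> :: real
  defines "g \<equiv> \<lambda>x. k x * exp (- (c * exp (- x)))"
  assumes c: "0 < c" and n: "2 \<le> n"
    and k_le: "\<And>x. \<bar>k x\<bar> \<le> M" and k_lip: "\<And>x y. \<bar>k x - k y\<bar> \<le> L * \<bar>x - y\<bar>" and L: "0 \<le> L"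
    and u: "x \<le> u" "u \<le> x + 1 / n" and y: "y = exp (- x)"
    and r: "r \<le> 1" "1 - r \<le> \<mu> / n"
  shows "\<bar>g u * exp (- u) - g (x + 1 / n) * (y * r)\<bar>
    \<le> (L + M) * (y * exp (- (c * y) / 2)) / n * (1 + c * y + \<mu>)"
proof -
  let ?v = "x + 1 / n" and ?E = "\<lambda>x. exp (- (c * exp (- x)))"
  have M: "0 \<le> M" using k_le[of 0] by linarith
  have y0: "0 < y" using y by simp
  have e: "1 - 1 / n \<le> exp (- (1 / n))" using exp_ge_add_one_self[of "- (1 / n)"] by simp
  have ev: "exp (- ?v) = y * exp (- (1 / n))" unfolding y by (simp add: exp_add[symmetric])
  have v_ge: "y - y / n \<le> exp (- ?v)"
    using mult_left_mono[OF e, of y] y0 unfolding ev by (simp add: algebra_simps)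
  \<comment> \<open>Since \<open>2 \<le> n\<close>, \<open>exp (- x)\<close> at most halves across
    the cell; hence the halved exponent in the bound.\<close>
  have v_half: "y / 2 \<le> exp (- ?v)"
  proof -
    have "y / n \<le> y / 2" using y0 n by (intro divide_left_mono) auto
    then show ?thesis using v_ge by linarith
  qed
  have uy: "exp (- u) \<le> y" "exp (- ?v) \<le> exp (- u)" using u unfolding y by auto
  have Ev: "?E ?v \<le> exp (- (c * y) / 2)" using mult_left_mono[OF v_half, of c] c by simp
  have Euv: "?E u \<le> ?E ?v" using mult_left_mono[OF uy(2), of c] c by simp
  \<comment> \<open>Applying \<open>1 - z \<le> exp (- z)\<close> to the ratio of the two values
    keeps the decaying factor \<open>?E ?v\<close> in the error.\<close>
  have "?E ?v * (1 - c * (exp (- u) - exp (- ?v))) \<le> ?E ?v * exp (- (c * (exp (- u) - exp (- ?v))))"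
    using exp_ge_add_one_self[of "- (c * (exp (- u) - exp (- ?v)))"] by (intro mult_left_mono) auto
  also have "\<dots> = ?E u" by (simp add: exp_add[symmetric] algebra_simps)
  finally have "?E ?v - ?E u \<le> ?E ?v * (c * (exp (- u) - exp (- ?v)))"
    by (simp add: algebra_simps)
  also have "\<dots> \<le> ?E ?v * (c * (y / n))"
    using uy v_ge c by (intro mult_left_mono) auto
  finally have dE: "?E ?v - ?E u \<le> ?E ?v * (c * (y / n))" .
  have "\<bar>g u - g ?v\<bar> = \<bar>k u * (?E u - ?E ?v) + (k u - k ?v) * ?E ?v\<bar>"
    unfolding g_def by (simp add: algebra_simps)
  also have "\<dots> \<le> \<bar>k u\<bar> * (?E ?v - ?E u) + \<bar>k u - k ?v\<bar> * ?E ?v"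
    using Euv by (intro order_trans[OF abs_triangle_ineq]) (simp add: abs_mult)
  also have "\<dots> \<le> M * (?E ?v * (c * (y / n))) + (L * (1 / n)) * ?E ?v"
  proof (intro add_mono mult_mono dE k_le order_refl)
    have "L * \<bar>u - ?v\<bar> \<le> L * (1 / n)" using u L by (intro mult_left_mono) auto
    then show "\<bar>k u - k ?v\<bar> \<le> L * (1 / n)" using k_lip[of u ?v] by linarith
  qed (use M L n Euv in auto)
  finally have dg: "\<bar>g u - g ?v\<bar> \<le> ?E ?v * ((M * (c * y) + L) / n)"
    by (simp add: algebra_simps add_divide_distrib)
  have "y * (1 - r) \<le> y * (\<mu> / n)" using r y0 by (intro mult_left_mono) auto
  moreover have "y * r \<le> y" "y * (1 - r) = y - y * r" using r y0 by (auto simp: algebra_simps)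
  moreover have "0 \<le> y / n" using y0 n by simp
  moreover have "y - y / n \<le> exp (- u)" using uy v_ge by linarith
  moreover have "y * ((1 + \<mu>) / n) = y / n + y * (\<mu> / n)" by (simp add: algebra_simps add_divide_distrib)
  ultimately have de: "\<bar>exp (- u) - y * r\<bar> \<le> y * ((1 + \<mu>) / n)"
    using uy(1) unfolding abs_le_iff by linarith
  have mu: "0 \<le> \<mu>" using r n by (smt (verit) divide_less_0_iff)
  have "\<bar>g u * exp (- u) - g ?v * (y * r)\<bar> = \<bar>(g u - g ?v) * exp (- u) + g ?v * (exp (- u) - y * r)\<bar>"
    by (simp add: algebra_simps)
  also have "\<dots> \<le> \<bar>g u - g ?v\<bar> * exp (- u) + \<bar>g ?v\<bar> * \<bar>exp (- u) - y * r\<bar>"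
    by (intro order_trans[OF abs_triangle_ineq]) (simp add: abs_mult)
  also have "\<dots> \<le> (?E ?v * ((M * (c * y) + L) / n)) * y + (M * ?E ?v) * (y * ((1 + \<mu>) / n))"
  proof (intro add_mono mult_mono dg uy de)
    show "\<bar>g ?v\<bar> \<le> M * ?E ?v" unfolding g_def using k_le by (simp add: abs_mult)
  qed (use M L y0 c n in auto)
  also have "\<dots> = (y * ?E ?v) / n * (L + M * (c * y) + M * (1 + \<mu>))"
    by (simp add: algebra_simps add_divide_distrib)
  also have "\<dots> \<le> (y * ?E ?v) / n * ((L + M) * (1 + c * y + \<mu>))"
  proof (intro mult_left_mono)
    have "0 \<le> L * (c * y + \<mu>)" using L c y0 mu by simp
    then show "L + M * (c * y) + M * (1 + \<mu>) \<le> (L + M) * (1 + c * y + \<mu>)" by (simp add: algebra_simps)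
  qed (use y0 n in auto)
  also have "\<dots> \<le> (y * exp (- (c * y) / 2)) / n * ((L + M) * (1 + c * y + \<mu>))"
    using Ev y0 n L M c mu by (intro mult_right_mono divide_right_mono mult_left_mono) auto
  finally show ?thesis by (simp add: mult_ac)
qed

section \<open>The Stein bound\<close>

lemma abs_deriv_le_of_lipschitz:
  fixes h :: "real \<Rightarrow> real"
  assumes deriv: "(h has_real_derivative D) (at x)" and lip: "\<And>x y. \<bar>h x - h y\<bar> \<le> B * \<bar>x - y\<bar>"
  shows "\<bar>D\<bar> \<le> B"
proof (rule tendsto_upperbound)
  show "((\<lambda>\<epsilon>. \<bar>(h (x + \<epsilon>) - h x) / \<epsilon>\<bar>) \<longlongrightarrow> \<bar>D\<bar>) (at 0)"
    using deriv unfolding DERIV_def by (rule tendsto_rabs)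
  show "\<forall>\<^sub>F \<epsilon> in at 0. \<bar>(h (x + \<epsilon>) - h x) / \<epsilon>\<bar> \<le> B"
  proof (rule eventually_at_filter[THEN iffD2, OF always_eventually], intro allI impI)
    fix \<epsilon> :: real assume "\<epsilon> \<noteq> 0"
    then show "\<bar>(h (x + \<epsilon>) - h x) / \<epsilon>\<bar> \<le> B" using lip[of "x + \<epsilon>" x] by (simp add: divide_le_eq)
  qed
qed simp

lemma summation_by_parts:
  fixes a b :: "nat \<Rightarrow> real"
  shows "(\<Sum>m<K. a (Suc m) * (b (Suc m) - b m)) = a K * b K - a 0 * b 0 + (\<Sum>m<K. (a m - a (Suc m)) * b m)"
  by (induction K) (simp_all add: algebra_simps)

text \<open>Here \<open>r\<close> compares \<open>(1 - 1 / N) ^ m\<close> with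
  \<open>exp (- m / N)\<close>. Its base lies between \<open>1 - 1 / N^2\<close> and 1, and
  Bernoulli's inequality turns this into the linear defect \<open>m / N^2\<close>.\<close>

lemma geometric_exp_ratio:
  fixes N :: real and m :: nat
  assumes N: "2 \<le> N"
  defines "r \<equiv> (1 - 1 / N) ^ m * exp (real m / N)"
  shows "r \<le> 1" and "1 - r \<le> real m / N / N"
proof -
  have r: "r = ((1 - 1 / N) * exp (1 / N)) ^ m"
    unfolding r_def power_mult_distrib by (simp add: exp_of_nat_mult[symmetric])
  have p0: "0 \<le> 1 - 1 / N" using N by simp
  have "(1 - 1 / N) * exp (1 / N) \<le> exp (- (1 / N)) * exp (1 / N)"
    using exp_ge_add_one_self[of "- (1 / N)"] by (intro mult_right_mono) auto
  also have "\<dots> = 1" by (simp add: exp_add[symmetric])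
  finally show "r \<le> 1" unfolding r using p0 by (intro power_le_one) auto
  have sq: "1 / N / N \<le> 1"
  proof -
    have "1 / N / N \<le> 1 / 1 / 1" using N by (intro frac_le) auto
    then show ?thesis by simp
  qed
  have "1 + real m * (- (1 / N / N)) \<le> (1 + (- (1 / N / N))) ^ m"
    by (rule Bernoulli_inequality) (use sq in simp)
  also have "1 + (- (1 / N / N)) = (1 - 1 / N) * (1 + 1 / N)" using N by (simp add: field_simps)
  also have "((1 - 1 / N) * (1 + 1 / N)) ^ m \<le> r"
    unfolding r using p0 N exp_ge_add_one_self[of "1 / N"] by (intro power_mono mult_left_mono) auto
  finally show "1 - r \<le> real m / N / N" by simp
qed

text \<open>The first term pays for passing from \<open>N\<close> to \<open>n\<close> coupons, the
  second for the Riemann sum; 73728 = 3 * 24576 joins the telescoping and the weight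
  constants.\<close>

lemma coupon_stein_bound:
  fixes k :: "real \<Rightarrow> real" and c L M :: real and n :: nat
  assumes c: "1 \<le> c" and n: "1 \<le> n" and L: "0 \<le> L"
    and k_le: "\<And>x. \<bar>k x\<bar> \<le> M" and k_lip: "\<And>x y. \<bar>k x - k y\<bar> \<le> L * \<bar>x - y\<bar>"
  defines "N \<equiv> Suc n"
  defines "g \<equiv> \<lambda>x. k x * exp (- (c * exp (- x)))"
  shows "\<bar>\<integral>\<omega>. exp (- coupon_Z N \<omega>) * (\<integral>y. g (coupon_Z N \<omega> + y) \<partial>expo1) - g (coupon_Z N \<omega>) \<partial>draws N\<bar>
    \<le> M / (c * real N) * (1 + harm n)
      + 73728 * (L + M) * (1 + (ln c + ln (real N))) / (c * real N)"
proof -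
  define H where "H x = exp (- x) * (\<integral>y. g (x + y) \<partial>expo1)" for x
  define x where "x m = real m / real N - ln (real N)" for m
  define \<phi> where "\<phi> m = H (x m) - g (x m)" for m
  define F where "F = cover_prob N N"
  define F' where "F' = cover_prob n n"
  define p where "p = 1 - 1 / real N"
  \<comment> \<open>\<open>I m\<close> is the integral of \<open>g u * exp (- u)\<close> over the
    cell from \<open>x m\<close> to \<open>x (Suc m)\<close>.\<close>
  define I where "I m = H (x m) - H (x (Suc m))" for m
  let ?K = "73728 * (L + M) * (1 + (ln c + ln (real N))) / (c * real N)"
  have N: "2 \<le> real N" and N0: "0 < N" using n by (auto simp: N_def)
  have M: "0 \<le> M" using k_le[of 0] by linarith
  have cont: "continuous_on UNIV g"
  proof -
    have "L-lipschitz_on UNIV k" using L k_lip by (intro lipschitz_onI) (auto simp: dist_real_def)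
    then show ?thesis unfolding g_def
      by (intro continuous_intros) (auto dest: lipschitz_on_continuous_on)
  qed
  have g_le: "\<bar>g u\<bar> \<le> M * exp (- (c * exp (- u)))" for u
    unfolding g_def using k_le by (simp add: abs_mult)
  have g_M: "\<bar>g u\<bar> \<le> M" for u
  proof -
    have "M * exp (- (c * exp (- u))) \<le> M * 1" using M c by (intro mult_left_mono) auto
    then show ?thesis using g_le[of u] by linarith
  qed
  note H' = expo1_average(1)[OF cont g_M, folded H_def]
  note H_le = expo1_average(2)[OF cont g_M, folded H_def]
  have x_Suc: "x (Suc m) = x m + 1 / real N" for m by (simp add: x_def add_divide_distrib)
  have exp_x: "exp (- x m) = real N * exp (- (1 / real N)) ^ m" for m
  proof -
    have "exp (- (1 / real N)) ^ m = exp (- (real m / real N))"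
      by (simp add: exp_of_nat_mult[symmetric])
    then show ?thesis using N0 by (simp add: x_def exp_diff exp_minus divide_inverse)
  qed
  have exp_x': "exp (- x m) * exp (real m / real N) = real N" for m
    using N0 by (simp add: x_def exp_add[symmetric])
  \<comment> \<open>All grid points satisfy \<open>x m \<ge> - ln N\<close>, so
    \<open>exp (- x m) \<le> N\<close> and \<open>\<phi>\<close> is bounded as the expectation
    formula requires.\<close>
  have \<phi>_le: "\<bar>\<phi> m\<bar> \<le> M * real N + M" for m
  proof -
    have "M * exp (- x m) \<le> M * real N"
      unfolding exp_x using M by (intro mult_left_mono mult_left_le power_le_one) auto
    then show ?thesis using H_le[of "x m"] g_M[of "x m"] unfolding \<phi>_def by linarith
  qed
  have F_Suc: "F (Suc m) - F m = p ^ m * F' m" for m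
    using cover_prob_increment[of n n m] n unfolding F_def F'_def p_def N_def by simp
  have F_0: "F 0 = 0" unfolding F_def N_def by simp
  have F: "0 \<le> F m" "F m \<le> 1" for m
    using cover_prob_bounds[of N N m] N0 by (auto simp: F_def)
  have F': "0 \<le> F' m" "F' m \<le> 1" for m
    using cover_prob_bounds[of n n m] n by (auto simp: F'_def)
  \<comment> \<open>First one coupon fewer has to be covered, then one coupon fewer is in the
    urn.\<close>
  have FF': "F m \<le> F' m" for m
  proof -
    have "F m \<le> cover_prob N n m" unfolding F_def N_def by (rule cover_prob_decreasing) auto
    also have "\<dots> \<le> F' m" unfolding F'_def N_def by (rule cover_prob_antimono) (use n in auto)
    finally show ?thesis .
  qed
  have mvt: "\<exists>u. x m \<le> u \<and> u \<le> x m + 1 / real N \<and> I m = g u * exp (- u) / real N" for m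
  proof -
    obtain u where "x m < u" "u < x (Suc m)"
      and "H (x (Suc m)) - H (x m) = (x (Suc m) - x m) * - (g u * exp (- u))"
      using MVT2[of "x m" "x (Suc m)" H "\<lambda>u. - (g u * exp (- u))"] H' N0 by (auto simp: x_Suc)
    then show ?thesis unfolding I_def x_Suc by (intro exI[of _ u]) (auto simp: algebra_simps)
  qed
  \<comment> \<open>\<open>H\<close> has Lipschitz constant \<open>M / c\<close>, because
    \<open>exp (- (c * z)) * z \<le> 1 / c\<close>; the cell has width \<open>1 / N\<close>.\<close>
  have I_le: "\<bar>I m\<bar> \<le> M / (c * real N)" for m
  proof -
    obtain u where u: "I m = g u * exp (- u) / real N" using mvt by blast
    have "\<bar>g u\<bar> * exp (- u) \<le> M * exp (- (c * exp (- u))) * exp (- u)"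
      by (intro mult_right_mono g_le) auto
    also have "\<dots> \<le> M * (1 / c)"
      unfolding mult.assoc using c M by (intro mult_left_mono x_exp_minus_le) auto
    finally have "\<bar>g u\<bar> * exp (- u) / real N \<le> M * (1 / c) / real N"
      by (intro divide_right_mono) auto
    then show ?thesis unfolding u using N0 by (simp add: abs_mult)
  qed
  \<comment> \<open>\<open>w m\<close> is the square root of \<open>c * exp (- x m)\<close>, a
    geometric sequence of the form summed in \<open>sum_log_scale_le\<close>.\<close>
  define w where "w m = sqrt (c * real N) * exp (- (1 / (2 * real N))) ^ m" for m
  have w: "0 < w m" "(w m)\<^sup>2 = c * exp (- x m)" for m
  proof -
    show "0 < w m" using c N0 by (simp add: w_def)
    have "(exp (- (1 / (2 * real N))) ^ m)\<^sup>2 = (exp (- (1 / (2 * real N))) ^ 2) ^ m"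
      by (simp add: power_mult[symmetric] mult.commute)
    also have "exp (- (1 / (2 * real N))) ^ 2 = exp (- (1 / real N))"
      by (simp add: exp_of_nat_mult[symmetric])
    finally show "(w m)\<^sup>2 = c * exp (- x m)"
      using c N0 by (simp add: w_def power_mult_distrib exp_x)
  qed
  have step: "\<bar>I m - g (x (Suc m)) * p ^ m\<bar>
      \<le> 24576 * (L + M) * (1 + (ln c + ln (real N))) / (c * real N) * (w m / (1 + w m)\<^sup>2 / real N)" for m
  proof -
    obtain u where u: "x m \<le> u" "u \<le> x m + 1 / real N" "I m = g u * exp (- u) / real N"
      using mvt by blast
    let ?y = "exp (- x m)" and ?r = "p ^ m * exp (real m / real N)"
    have yr: "?y * ?r = real N * p ^ m" using exp_x'[of m] by (simp add: mult_ac)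
    \<comment> \<open>The defect parameter \<open>m / N\<close> is rewritten in terms of
      \<open>w m\<close>, with \<open>A = ln c + ln N\<close> in
      \<open>log_weight_bound\<close>.\<close>
    have lnw: "ln c + ln (real N) - ln ((w m)\<^sup>2) = real m / real N"
      unfolding w(2) using c by (simp add: ln_mult x_def)
    have "I m - g (x (Suc m)) * p ^ m = (g u * exp (- u) - g (x m + 1 / real N) * (?y * ?r)) / real N"
      unfolding yr u(3) x_Suc using N0 by (simp add: diff_divide_distrib)
    then have "\<bar>I m - g (x (Suc m)) * p ^ m\<bar>
        = \<bar>g u * exp (- u) - g (x m + 1 / real N) * (?y * ?r)\<bar> / real N" by simp
    also have "\<dots> \<le> (L + M) * (?y * exp (- (c * ?y) / 2)) / real N * (1 + c * ?y + real m / real N) / real N"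
      unfolding g_def p_def using c
      by (intro divide_right_mono gumbel_weight_step geometric_exp_ratio N k_le k_lip L u refl) auto
    also have "\<dots> = (L + M) / (c * real N)
        * ((w m)\<^sup>2 * exp (- (w m)\<^sup>2 / 2) * (1 + (w m)\<^sup>2 + (ln c + ln (real N) - ln ((w m)\<^sup>2)))) / real N"
      unfolding lnw unfolding w(2) using c N0 by (simp add: field_simps)
    also have "\<dots> \<le> (L + M) / (c * real N)
        * (24576 * (1 + (ln c + ln (real N))) * (w m / (1 + w m)\<^sup>2)) / real N"
      using L M c N by (intro divide_right_mono mult_left_mono log_weight_bound w) auto
    also have "S / d * (24576 * B * W) / e = 24576 * S * B / d * (W / e)" for S d B W e :: real by simp
    finally show ?thesis .
  qed
  \<comment> \<open>The subtracted \<open>M * exp (- x J)\<close> accounts for the boundary term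
    \<open>H (x J) * F J\<close> and vanishes in the limit.\<close>
  have partial: "\<bar>\<Sum>m<J. \<phi> (Suc m) * (F (Suc m) - F m)\<bar> - M * exp (- x J)
      \<le> M / (c * real N) * (1 + harm n) + ?K" for J
  proof -
    have "(\<Sum>m<J. \<phi> (Suc m) * (F (Suc m) - F m))
       = (\<Sum>m<J. H (x (Suc m)) * (F (Suc m) - F m)) - (\<Sum>m<J. g (x (Suc m)) * (p ^ m * F' m))"
      unfolding \<phi>_def F_Suc by (simp add: sum_subtractf[symmetric] left_diff_distrib)
    also have "(\<Sum>m<J. H (x (Suc m)) * (F (Suc m) - F m)) = H (x J) * F J + (\<Sum>m<J. I m * F m)"
      using summation_by_parts[of "\<lambda>m. H (x m)" F J] F_0 by (simp add: I_def)
    \<comment> \<open>\<open>F m\<close> is written as \<open>F' m - (F' m - F m)\<close>, so that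
      the cell integrals and the Riemann terms carry the same weight \<open>F' m\<close>.\<close>
    finally have eq: "(\<Sum>m<J. \<phi> (Suc m) * (F (Suc m) - F m)) = H (x J) * F J
        - (\<Sum>m<J. I m * (F' m - F m)) + (\<Sum>m<J. (I m - g (x (Suc m)) * p ^ m) * F' m)"
      by (simp add: sum_subtractf sum.distrib algebra_simps)
    have a: "\<bar>H (x J) * F J\<bar> \<le> M * exp (- x J)"
      using mult_mono[OF H_le[of "x J"] F(2)[of J]] F[of J] M by (simp add: abs_mult)
    have b: "\<bar>\<Sum>m<J. I m * (F' m - F m)\<bar> \<le> M / (c * real N) * (1 + harm n)"
    proof -
      have "\<bar>\<Sum>m<J. I m * (F' m - F m)\<bar> \<le> (\<Sum>m<J. M / (c * real N) * (F' m - F m))"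
      proof (intro order_trans[OF sum_abs] sum_mono)
        fix m
        show "\<bar>I m * (F' m - F m)\<bar> \<le> M / (c * real N) * (F' m - F m)"
          using mult_right_mono[OF I_le[of m], of "F' m - F m"] FF'[of m] by (simp add: abs_mult)
      qed
      also have "\<dots> \<le> M / (c * real N) * (1 + harm n)"
        using sum_cover_prob_diff_le[of n J] n M c unfolding sum_distrib_left[symmetric] F_def F'_def N_def
        by (intro mult_left_mono) auto
      finally show ?thesis .
    qed
    have d: "\<bar>\<Sum>m<J. (I m - g (x (Suc m)) * p ^ m) * F' m\<bar> \<le> ?K"
    proof -
      let ?Q = "24576 * (L + M) * (1 + (ln c + ln (real N))) / (c * real N)"
      have "\<bar>\<Sum>m<J. (I m - g (x (Suc m)) * p ^ m) * F' m\<bar> \<le> (\<Sum>m<J. \<bar>I m - g (x (Suc m)) * p ^ m\<bar>)"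
        using F' by (intro order_trans[OF sum_abs] sum_mono) (auto simp: abs_mult intro!: mult_left_le)
      also have "\<dots> \<le> (\<Sum>m<J. ?Q * (w m / (1 + w m)\<^sup>2 / real N))" by (intro sum_mono step)
      also have "\<dots> \<le> ?Q * 3"
        unfolding sum_distrib_left[symmetric] w_def using L M c N
        by (intro mult_left_mono sum_log_scale_le) auto
      also have "24576 * S * B / d * 3 = 73728 * S * B / d" for S B d :: real by simp
      finally show ?thesis .
    qed
    show ?thesis unfolding eq using a b d by linarith
  qed
  have "(\<lambda>J. \<bar>\<Sum>m<J. \<phi> (Suc m) * (F (Suc m) - F m)\<bar> - M * exp (- x J))
      \<longlonglongrightarrow> \<bar>\<integral>\<omega>. \<phi> (coupon_T N \<omega>) \<partial>draws N\<bar> - M * (real N * 0)"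
    unfolding exp_x F_def
    by (intro tendsto_diff tendsto_rabs coupon_T_expectation[OF N0 \<phi>_le] tendsto_mult tendsto_const
        LIMSEQ_power_zero) (use N0 in simp)
  then have "\<bar>\<integral>\<omega>. \<phi> (coupon_T N \<omega>) \<partial>draws N\<bar> - M * (real N * 0) \<le> M / (c * real N) * (1 + harm n) + ?K"
    by (rule LIMSEQ_le_const2) (use partial in blast)
  then show ?thesis by (simp add: \<phi>_def H_def x_def coupon_Z_def)
qed

theorem theorem3p8:
  fixes h :: "real \<Rightarrow> real"
  assumes "lip2 h"
  shows "\<exists>C>0. \<forall>t::real. \<forall>n::nat. t \<ge> 1 \<longrightarrow> n \<ge> 2 \<longrightarrow>
    \<bar>\<integral>\<omega>. L0 (P0 t h) (coupon_Z n \<omega>) \<partial>draws n\<bar>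
      \<le> C * ((1 + \<bar>ln (gamma_t t)\<bar>) / gamma_t t) * (ln (real n) / real n)"
proof -
  obtain M h' L where M: "M-lipschitz_on UNIV h" and h': "\<And>x. (h has_real_derivative h' x) (at x)"
    and L: "L-lipschitz_on UNIV h'"
    using assms unfolding lip2_def by blast
  have h_lip: "\<bar>h x - h y\<bar> \<le> M * \<bar>x - y\<bar>" for x y
    using lipschitz_onD[OF M, of x y] by (simp add: dist_real_def)
  have h'_lip: "\<bar>h' x - h' y\<bar> \<le> L * \<bar>x - y\<bar>" for x y
    using lipschitz_onD[OF L, of x y] by (simp add: dist_real_def)
  have h'_le: "\<bar>h' x\<bar> \<le> M" for x using abs_deriv_le_of_lipschitz[OF h' h_lip] .
  have M0: "0 \<le> M" and L0: "0 \<le> L" using lipschitz_on_nonneg M L by auto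
  \<comment> \<open>\<open>5 * M\<close> comes from the harmonic number, 221184 = 3 * 73728 from the
    Riemann sum; the final 1 makes the constant positive.\<close>
  let ?C = "5 * M + 221184 * (L + M) + 1"
  have "\<bar>\<integral>\<omega>. L0 (P0 t h) (coupon_Z n \<omega>) \<partial>draws n\<bar>
      \<le> ?C * ((1 + \<bar>ln (gamma_t t)\<bar>) / gamma_t t) * (ln (real n) / real n)"
    if t: "t \<ge> 1" and n: "n \<ge> 2" for t n
  proof -
    define c where "c = gamma_t t"
    \<comment> \<open>\<open>exp t - 1 \<ge> t \<ge> 1\<close>, so \<open>ln c\<close> is
      nonnegative and equals its absolute value.\<close>
    have c: "1 \<le> c" unfolding c_def gamma_t_def using exp_ge_add_one_self[of t] t by linarith
    obtain m where m: "n = Suc m" "1 \<le> m" using n by (cases n) auto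
    have lnc: "0 \<le> ln c" using c by simp
    have "ln 2 \<le> ln (real n)" using n by simp
    then have lnn: "1 / 2 \<le> ln (real n)" using ln2_ge_two_thirds by linarith
    have "harm m - ln (real m) \<le> harm 1 - ln (real 1)"
      using euler_mascheroni_sequence_decreasing[of 1 m] m by simp
    moreover have "ln (real m) \<le> ln (real n)" using m by simp
    \<comment> \<open>\<open>1 + harm m \<le> 2 + ln n\<close>, and
      \<open>2 \<le> 4 * ln n\<close>.\<close>
    ultimately have harm: "1 + harm m \<le> 5 * ln (real n)" using lnn by (simp add: harm_def)
    have prod: "0 \<le> (1 + ln c) * (ln (real n) - 1 / 2)" "0 \<le> ln c * ln (real n)"
      using lnc lnn by (auto intro!: mult_nonneg_nonneg)
    have logs: "1 + (ln c + ln (real n)) \<le> 3 * ((1 + ln c) * ln (real n))"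
      using prod lnn by (simp add: algebra_simps)
    have harm': "1 + harm m \<le> 5 * ((1 + ln c) * ln (real n))"
      using harm prod by (simp add: algebra_simps)
    have "\<bar>\<integral>\<omega>. L0 (P0 t h) (coupon_Z n \<omega>) \<partial>draws n\<bar>
      \<le> M / (c * real n) * (1 + harm m) + 73728 * (L + M) * (1 + (ln c + ln (real n))) / (c * real n)"
      \<comment> \<open>The shift by \<open>t\<close> goes into \<open>k\<close>, which keeps the
        bounds \<open>M\<close> and \<open>L\<close> independent of \<open>t\<close>.\<close>
      using coupon_stein_bound[OF c m(2) L0, of "\<lambda>x. h' (x - t)" M] h'_le h'_lip[of "_ - t" "_ - t"] t
      by (simp add: m(1) c_def L0_P0_decomposition[OF h' h_lip])
    also have "\<dots> \<le> M / (c * real n) * (5 * ((1 + ln c) * ln (real n)))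
        + 73728 * (L + M) * (3 * ((1 + ln c) * ln (real n))) / (c * real n)"
      using M0 L0 c by (intro add_mono mult_left_mono divide_right_mono harm' logs) auto
    also have "\<dots> = (?C - 1) * ((1 + ln c) / c) * (ln (real n) / real n)"
      by (simp add: algebra_simps add_divide_distrib)
    also have "\<dots> \<le> ?C * ((1 + ln c) / c) * (ln (real n) / real n)"
      using lnc c lnn by (intro mult_right_mono) auto
    finally show ?thesis using lnc by (simp add: c_def)
  qed
  moreover have "0 < ?C" using M0 L0 by simp
  ultimately show ?thesis by blast
qed

end
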